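(* Let $(L,\leqslant)$ be a (nonempty) poset. Then $L$ is a bc-domain if and only if there exists a bc-approximation space $(U,R,\mathcal F)$ such that $(\mathfrak C(U,R,\mathcal F),\subseteq)$ is order-isomorphic to $(L,\leqslant)$.
   Context: Upper approximation: for a set $U$, a binary relation $R$ on $U$ and $A\subseteq U$, put $\overline R(A)=\{x\in U\mid \exists y\in A,\ xRy\}$. $K\subseteq_{fin}X$ means that $K$ is a finite (possibly empty) subset of $X$, and $\mathcal P_{fin}(U)$ is the set of all finite subsets of $U$. CF-approximation space: a triple $(U,R,\mathcal F)$ with $R$ a transitive relation on the set $U$ and $\emptyset\neq\mathcal F\subseteq\mathcal P_{fin}(U)$ such that for every $F\in\mathcal F$ and every $K\subseteq_{fin}\overline R(F)$ there is $G\in\mathcal F$ with $K\subseteq\overline R(G)$ and $G\subseteq\overline R(F)$. CF-closed set: $E\subseteq U$ such that for every $K\subseteq_{fin}E$ there is $F\in\mathcal F$ with $K\subseteq\overline R(F)\subseteq E$ and $F\subseteq E$. $\mathfrak C(U,R,\mathcal F)$ is the set of all CF-closed sets. Join saturation: $\mathcal F^{\sharp}$ is the set of all unions $\bigcup\mathcal A$ of nonempty finite subfamilies $\mathcal A\subseteq\mathcal F$. bc-approximation space: a CF-approximation space $(U,R,\mathcal F)$ such that for all $M\in\mathcal F^{\sharp}\cup\{\emptyset\}$ and $F\in\mathcal F$ with $M\subseteq\overline R(F)$ there is $G\in\mathcal F$ satisfying: (sL-1) $\overline R(M)\subseteq\overline R(G)\subseteq\overline R(F)$; and (sL-$2'$)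 for all $G'\in\mathcal F$, $\overline R(M)\subseteq\overline R(G')$ implies $\overline R(G)\subseteq\overline R(G')$. Domains: directed sets are nonempty; a dcpo is a poset in which every directed subset has a supremum. $x\ll y$ means that for every directed $D$ having a supremum with $\sup D\geqslant y$ there is $d\in D$ with $x\leqslant d$. A continuous domain is a dcpo in which, for every $x$, the set $\{y\mid y\ll x\}$ is directed with supremum $x$. A bc-domain is a continuous domain in which every subset having an upper bound (including the empty subset) has a supremum. *)

theory Defs
  imports Main
begin

text \<open>
  A poset is a carrier \<open>L\<close> together with a set of pairs \<open>r\<close> such that \<open>partial_order_on L r\<close>;
  \<open>(x, y) \<in> r\<close> reads \<open>x \<le> y\<close>. In this situation \<open>Field r = L\<close>, so that \<open>Above r A\<close> is the set of
  all upper bounds of \<open>A\<close> in \<open>L\<close>.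
\<close>

definition is_supremum :: "'a rel \<Rightarrow> 'a set \<Rightarrow> 'a \<Rightarrow> bool" where
  "is_supremum r A s \<longleftrightarrow> s \<in> Above r A \<and> (\<forall>u\<in>Above r A. (s, u) \<in> r)"

definition directed_in :: "'a set \<Rightarrow> 'a rel \<Rightarrow> 'a set \<Rightarrow> bool" where
  "directed_in L r D \<longleftrightarrow>
     D \<subseteq> L \<and> D \<noteq> {} \<and> (\<forall>x\<in>D. \<forall>y\<in>D. \<exists>z\<in>D. (x, z) \<in> r \<and> (y, z) \<in> r)"

definition dcpo :: "'a set \<Rightarrow> 'a rel \<Rightarrow> bool" where
  "dcpo L r \<longleftrightarrow> partial_order_on L r \<and> (\<forall>D. directed_in L r D \<longrightarrow> (\<exists>s. is_supremum r D s))"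

definition way_below :: "'a set \<Rightarrow> 'a rel \<Rightarrow> 'a \<Rightarrow> 'a \<Rightarrow> bool" where
  "way_below L r x y \<longleftrightarrow>
     (\<forall>D s. directed_in L r D \<and> is_supremum r D s \<and> (y, s) \<in> r \<longrightarrow> (\<exists>d\<in>D. (x, d) \<in> r))"

definition continuous_domain :: "'a set \<Rightarrow> 'a rel \<Rightarrow> bool" where
  "continuous_domain L r \<longleftrightarrow>
     dcpo L r \<and>
     (\<forall>x\<in>L. directed_in L r {y \<in> L. way_below L r y x} \<and>
            is_supremum r {y \<in> L. way_below L r y x} x)"

definition bc_domain :: "'a set \<Rightarrow> 'a rel \<Rightarrow> bool" where
  "bc_domain L r \<longleftrightarrow>
     continuous_domain L r \<and>
     (\<forall>A. A \<subseteq> L \<and> Above r A \<noteq> {} \<longrightarrow> (\<exists>s. is_supremum r A s))"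

definition order_isomorphic :: "'a set \<Rightarrow> 'a rel \<Rightarrow> 'b set \<Rightarrow> 'b rel \<Rightarrow> bool" where
  "order_isomorphic A r B s \<longleftrightarrow>
     (\<exists>f. bij_betw f A B \<and> (\<forall>x\<in>A. \<forall>y\<in>A. (x, y) \<in> r \<longleftrightarrow> (f x, f y) \<in> s))"

definition upper_approx :: "'a set \<Rightarrow> 'a rel \<Rightarrow> 'a set \<Rightarrow> 'a set" where
  "upper_approx U R A = {x \<in> U. \<exists>y\<in>A. (x, y) \<in> R}"

definition cf_approx_space :: "'a set \<Rightarrow> 'a rel \<Rightarrow> 'a set set \<Rightarrow> bool" where
  "cf_approx_space U R \<F> \<longleftrightarrow>
     R \<subseteq> U \<times> U \<and> trans R \<and>
     \<F> \<noteq> {} \<and> \<F> \<subseteq> {F. F \<subseteq> U \<and> finite F} \<and>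
     (\<forall>F\<in>\<F>. \<forall>K. finite K \<and> K \<subseteq> upper_approx U R F \<longrightarrow>
        (\<exists>G\<in>\<F>. K \<subseteq> upper_approx U R G \<and> G \<subseteq> upper_approx U R F))"

definition cf_closed_sets :: "'a set \<Rightarrow> 'a rel \<Rightarrow> 'a set set \<Rightarrow> 'a set set" where
  "cf_closed_sets U R \<F> =
     {E. E \<subseteq> U \<and>
         (\<forall>K. finite K \<and> K \<subseteq> E \<longrightarrow>
            (\<exists>F\<in>\<F>. K \<subseteq> upper_approx U R F \<and> upper_approx U R F \<subseteq> E \<and> F \<subseteq> E))}"

definition join_saturation :: "'a set set \<Rightarrow> 'a set set" where
  "join_saturation \<F> = {\<Union>\<A> | \<A>. \<A> \<subseteq> \<F> \<and> finite \<A> \<and> \<A> \<noteq> {}}"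

definition bc_approx_space :: "'a set \<Rightarrow> 'a rel \<Rightarrow> 'a set set \<Rightarrow> bool" where
  "bc_approx_space U R \<F> \<longleftrightarrow>
     cf_approx_space U R \<F> \<and>
     (\<forall>M \<in> join_saturation \<F> \<union> {{}}. \<forall>F\<in>\<F>. M \<subseteq> upper_approx U R F \<longrightarrow>
        (\<exists>G\<in>\<F>.
           upper_approx U R M \<subseteq> upper_approx U R G \<and>
           upper_approx U R G \<subseteq> upper_approx U R F \<and>
           (\<forall>G'\<in>\<F>. upper_approx U R M \<subseteq> upper_approx U R G' \<longrightarrow>
                    upper_approx U R G \<subseteq> upper_approx U R G')))"

text \<open>
  The type \<open>'b\<close> of points of the approximation space is independent of the type \<open>'a\<close> of points of
  the poset, since an existential quantifier over spaces cannot range over types.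
\<close>

definition bc_represents ::
    "'b set \<Rightarrow> 'b rel \<Rightarrow> 'b set set \<Rightarrow> 'a set \<Rightarrow> 'a rel \<Rightarrow> bool" where
  "bc_represents U R \<F> L r \<longleftrightarrow>
     bc_approx_space U R \<F> \<and>
     order_isomorphic (cf_closed_sets U R \<F>) (relation_of (\<subseteq>) (cf_closed_sets U R \<F>)) L r"

end

theory Submission
  imports Defs
begin

text \<open>
  A continuous domain is represented by its singletons with the way-below relation: the CF-closed
  sets are then the rounded ideals, which correspond to the points by taking suprema, and
  \<open>(sL-1)\<close>, \<open>(sL-2')\<close> for \<open>M\<close> below \<open>x\<close> are witnessed by \<open>{sup M}\<close>. Conversely, the sets
  \<open>upper_approx U R F\<close> form a basis of the CF-closed sets, in which directed suprema are unions. The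
  set \<open>G\<close> of \<open>(sL-2')\<close> does not depend, up to \<open>upper_approx U R G\<close>, on the upper bound \<open>F\<close>, so a
  bounded family of CF-closed sets has as supremum the directed union of all \<open>upper_approx U R G\<close>,
  with \<open>G\<close> obtained from a finite union \<open>M\<close> of members of \<open>\<F>\<close> lying inside members of the family.
\<close>

section \<open>Suprema and invariance under order isomorphisms\<close>

lemma partial_order_on_simps:
  assumes "partial_order_on L r"
  shows partial_order_on_Field: "Field r = L"
    and partial_order_on_refl: "x \<in> L \<Longrightarrow> (x, x) \<in> r"
    and partial_order_on_trans: "(x, y) \<in> r \<Longrightarrow> (y, z) \<in> r \<Longrightarrow> (x, z) \<in> r"
    and partial_order_on_antisym: "(x, y) \<in> r \<Longrightarrow> (y, x) \<in> r \<Longrightarrow> x = y"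
  using assms
  by (auto simp: partial_order_on_def preorder_on_def refl_on_def Field_def
      dest: transD antisymD)

text \<open>\<open>Above\<close> is defined through \<open>Field r\<close>, which reflexivity
  identifies with \<open>L\<close>. With \<open>A\<close> empty, the right-hand side says that
  \<open>s\<close> is the least element of \<open>L\<close>.\<close>

lemma is_supremum_iff:
  assumes "partial_order_on L r"
  shows "is_supremum r A s \<longleftrightarrow>
    s \<in> L \<and> (\<forall>a\<in>A. (a, s) \<in> r) \<and> (\<forall>u\<in>L. (\<forall>a\<in>A. (a, u) \<in> r) \<longrightarrow> (s, u) \<in> r)"
  unfolding is_supremum_def Above_def partial_order_on_Field[OF assms] by auto

lemma is_supremum_unique:
  assumes "partial_order_on L r" "is_supremum r A s" "is_supremum r A t"
  shows "s = t"
  using assms(2,3) partial_order_on_antisym[OF assms(1)]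
  unfolding is_supremum_iff[OF assms(1)] by blast

text \<open>Needed because the map \<open>below\<close> goes from the poset to the CF-closed sets,
  whereas \<open>bc_represents\<close> asks for the opposite direction.\<close>

lemma order_isomorphic_sym:
  assumes "order_isomorphic A r B s"
  shows "order_isomorphic B s A r"
proof -
  obtain f where f: "bij_betw f A B" "\<forall>x\<in>A. \<forall>y\<in>A. (x, y) \<in> r \<longleftrightarrow> (f x, f y) \<in> s"
    using assms unfolding order_isomorphic_def by blast
  let ?g = "inv_into A f"
  have "bij_betw ?g B A" using f(1) by (rule bij_betw_inv_into)
  moreover have "(x, y) \<in> s \<longleftrightarrow> (?g x, ?g y) \<in> r" if "x \<in> B" "y \<in> B" for x y
  proof -
    have "?g x \<in> A" "?g y \<in> A" using that \<open>bij_betw ?g B A\<close> by (auto dest: bij_betwE)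
    then show ?thesis using f(2) that by (simp add: bij_betw_inv_into_right[OF f(1)])
  qed
  ultimately show ?thesis unfolding order_isomorphic_def by blast
qed

section \<open>Transfer of domain notions along an order isomorphism\<close>

locale order_iso =
  fixes A :: "'a set" and r :: "'a rel" and B :: "'b set" and s :: "'b rel" and f :: "'a \<Rightarrow> 'b"
  assumes po_A: "partial_order_on A r" and po_B: "partial_order_on B s"
    and bij: "bij_betw f A B"
    and order_iff: "\<And>x y. x \<in> A \<Longrightarrow> y \<in> A \<Longrightarrow> (f x, f y) \<in> s \<longleftrightarrow> (x, y) \<in> r"
begin

lemma image_eq: "f ` A = B"
  using bij by (simp add: bij_betw_def)

lemma is_supremum_image:
  assumes "D \<subseteq> A" "x \<in> A"
  shows "is_supremum s (f ` D) (f x) \<longleftrightarrow> is_supremum r D x"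
proof -
  have "(\<forall>d\<in>D. (f d, f u) \<in> s) \<longleftrightarrow> (\<forall>d\<in>D. (d, u) \<in> r)" if "u \<in> A" for u
    using assms that order_iff by blast
  then show ?thesis
    using assms
    by (simp add: is_supremum_iff[OF po_A] is_supremum_iff[OF po_B] image_eq[symmetric] order_iff)
qed

lemma directed_in_image:
  assumes "D \<subseteq> A"
  shows "directed_in B s (f ` D) \<longleftrightarrow> directed_in A r D"
proof -
  have "(f x, f z) \<in> s \<longleftrightarrow> (x, z) \<in> r" if "x \<in> D" "z \<in> D" for x z
    using assms that order_iff by blast
  then show ?thesis
    using assms image_eq unfolding directed_in_def by auto
qed

text \<open>One half pushes the test set \<open>D\<close> forward along \<open>f\<close>; the other
  pulls it back, since surjectivity makes every subset of \<open>B\<close> the image of a subset of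
  \<open>A\<close>.\<close>

lemma way_below_image:
  assumes "x \<in> A" "y \<in> A"
  shows "way_below B s (f x) (f y) \<longleftrightarrow> way_below A r x y"
proof
  assume wb: "way_below B s (f x) (f y)"
  show "way_below A r x y"
    unfolding way_below_def
  proof (intro allI impI, elim conjE)
    fix D t assume D: "directed_in A r D" "is_supremum r D t" "(y, t) \<in> r"
    then have sub: "D \<subseteq> A" "t \<in> A"
      by (auto simp: directed_in_def is_supremum_iff[OF po_A])
    then have "\<exists>d\<in>f ` D. (f x, d) \<in> s"
      using wb D assms unfolding way_below_def
      by (metis directed_in_image is_supremum_image order_iff)
    then show "\<exists>d\<in>D. (x, d) \<in> r" using sub assms order_iff by blast
  qed
next
  assume wb: "way_below A r x y"
  show "way_below B s (f x) (f y)"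
    unfolding way_below_def
  proof (intro allI impI, elim conjE)
    fix D' t' assume D': "directed_in B s D'" "is_supremum s D' t'" "(f y, t') \<in> s"
    then have "D' \<subseteq> f ` A" "t' \<in> f ` A"
      by (auto simp: directed_in_def is_supremum_iff[OF po_B] image_eq)
    then obtain D t where D: "D \<subseteq> A" "D' = f ` D" "t \<in> A" "t' = f t"
      by (auto simp: subset_image_iff)
    then have "\<exists>d\<in>D. (x, d) \<in> r"
      using wb D' assms unfolding way_below_def
      by (metis directed_in_image is_supremum_image order_iff)
    then show "\<exists>d\<in>D'. (f x, d) \<in> s" using D assms order_iff by blast
  qed
qed

lemma way_below_set_image:
  assumes "x \<in> A"
  shows "{y \<in> B. way_below B s y (f x)} = f ` {y \<in> A. way_below A r y x}"
  using assms way_below_image by (auto simp: image_eq[symmetric])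

lemma bc_domain_transfer:
  assumes "bc_domain A r"
  shows "bc_domain B s"
proof -
  have cd: "continuous_domain A r"
    and bc: "\<And>D. D \<subseteq> A \<Longrightarrow> Above r D \<noteq> {} \<Longrightarrow> \<exists>t. is_supremum r D t"
    using assms by (auto simp: bc_domain_def)
  have sup: "\<exists>t. is_supremum s (f ` D) t" if "D \<subseteq> A" "is_supremum r D t" for D t
    using that is_supremum_image by (auto simp: is_supremum_iff[OF po_A])
  have "\<exists>t. is_supremum s D' t" if D': "directed_in B s D'" for D'
  proof -
    have "D' \<subseteq> f ` A" using D' by (simp add: directed_in_def image_eq)
    then obtain D where D: "D \<subseteq> A" "D' = f ` D" by (auto simp: subset_image_iff)
    then have "\<exists>t. is_supremum r D t"
      using D' cd directed_in_image by (auto simp: continuous_domain_def dcpo_def)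
    then show ?thesis using D sup by blast
  qed
  moreover have "directed_in B s {y \<in> B. way_below B s y x'} \<and>
      is_supremum s {y \<in> B. way_below B s y x'} x'" if x': "x' \<in> B" for x'
  proof -
    obtain x where x: "x \<in> A" "x' = f x" using x' by (auto simp: image_eq[symmetric])
    let ?D = "{y \<in> A. way_below A r y x}"
    have "directed_in A r ?D" "is_supremum r ?D x"
      using cd x by (auto simp: continuous_domain_def)
    then show ?thesis
      using x directed_in_image[of ?D] is_supremum_image[of ?D x] way_below_set_image[of x]
      by simp
  qed
  moreover have "\<exists>t. is_supremum s D' t" if D': "D' \<subseteq> B" "Above s D' \<noteq> {}" for D'
  proof -
    obtain D where D: "D \<subseteq> A" "D' = f ` D"
      using D'(1) by (auto simp: image_eq[symmetric] subset_image_iff)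
    \<comment> \<open>The preimage of an upper bound of \<open>D'\<close> bounds \<open>D\<close>,
      so bounded completeness of \<open>A\<close> applies to \<open>D\<close>.\<close>
    obtain u where "u \<in> A" "\<forall>d\<in>D. (f d, f u) \<in> s"
      using D' D by (auto simp: Above_def partial_order_on_Field[OF po_B] image_eq[symmetric])
    then have "u \<in> Above r D"
      using D order_iff by (auto simp: Above_def partial_order_on_Field[OF po_A])
    then show ?thesis using D bc sup by blast
  qed
  ultimately show ?thesis
    using po_B by (auto simp: bc_domain_def continuous_domain_def dcpo_def)
qed

end

lemma bc_domain_order_isomorphic:
  assumes "partial_order_on A r" "partial_order_on B s" "order_isomorphic A r B s" "bc_domain A r"
  shows "bc_domain B s"
proof -
  obtain f where "bij_betw f A B" "\<forall>x\<in>A. \<forall>y\<in>A. (x, y) \<in> r \<longleftrightarrow> (f x, f y) \<in> s"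
    using assms(3) unfolding order_isomorphic_def by blast
  then interpret order_iso A r B s f
    using assms by unfold_locales auto
  show ?thesis using assms(4) by (rule bc_domain_transfer)
qed

section \<open>The domain of CF-closed sets\<close>

lemma partial_order_on_relation_of_subset:
  "partial_order_on \<C> (relation_of (\<subseteq>) \<C>)"
  by (auto simp: partial_order_on_def preorder_on_def refl_on_def trans_def antisym_def
      relation_of_def)

text \<open>Finite sets are compact with respect to directed unions. Nonemptiness of the family
  settles \<open>K = {}\<close>; each further point costs one use of directedness.\<close>

lemma finite_subset_directed_Union:
  assumes "finite K" "K \<subseteq> \<Union>\<D>" "\<D> \<noteq> {}"
    and "\<And>X Y. X \<in> \<D> \<Longrightarrow> Y \<in> \<D> \<Longrightarrow> \<exists>Z\<in>\<D>. X \<subseteq> Z \<and> Y \<subseteq> Z"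
  shows "\<exists>X\<in>\<D>. K \<subseteq> X"
  using assms(1,2)
proof (induction K)
  case empty
  then show ?case using assms(3) by blast
next
  case (insert k K)
  then obtain X Y where "X \<in> \<D>" "K \<subseteq> X" "Y \<in> \<D>" "k \<in> Y" by blast
  then show ?case using assms(4)[of X Y] by blast
qed

lemma upper_approx_mono: "A \<subseteq> B \<Longrightarrow> upper_approx U R A \<subseteq> upper_approx U R B"
  by (auto simp: upper_approx_def)

lemma upper_approx_trans:
  "trans R \<Longrightarrow> A \<subseteq> upper_approx U R B \<Longrightarrow> upper_approx U R A \<subseteq> upper_approx U R B"
  by (fastforce simp: upper_approx_def dest: transD)

locale cf_space =
  fixes U :: "'b set" and R :: "'b rel" and \<F> :: "'b set set"
  assumes cf: "cf_approx_space U R \<F>"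
begin

abbreviation up :: "'b set \<Rightarrow> 'b set" where "up \<equiv> upper_approx U R"
abbreviation \<CC> :: "'b set set" where "\<CC> \<equiv> cf_closed_sets U R \<F>"
abbreviation le :: "'b set rel" where "le \<equiv> relation_of (\<subseteq>) \<CC>"

lemma trans_R: "trans R"
  using cf by (simp add: cf_approx_space_def)

lemma finite_F: "F \<in> \<F> \<Longrightarrow> finite F"
  using cf by (auto simp: cf_approx_space_def)

lemma up_interpolate:
  assumes "F \<in> \<F>" "finite K" "K \<subseteq> up F"
  shows "\<exists>G\<in>\<F>. K \<subseteq> up G \<and> G \<subseteq> up F"
  using cf assms by (simp add: cf_approx_space_def)

lemma closed_interpolate:
  assumes "E \<in> \<CC>" "finite K" "K \<subseteq> E"
  shows "\<exists>F\<in>\<F>. K \<subseteq> up F \<and> up F \<subseteq> E \<and> F \<subseteq> E"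
  using assms unfolding cf_closed_sets_def by blast

text \<open>Closedness puts \<open>F\<close> inside some \<open>up G\<close> that is contained in
  \<open>E\<close>, and transitivity of \<open>R\<close> then puts \<open>up F\<close> inside the
  same \<open>up G\<close>.\<close>

lemma up_subset_closed:
  assumes "E \<in> \<CC>" "finite F" "F \<subseteq> E"
  shows "up F \<subseteq> E"
proof -
  obtain G where "F \<subseteq> up G" "up G \<subseteq> E" using closed_interpolate[OF assms] by blast
  then show ?thesis using upper_approx_trans[OF trans_R] by blast
qed

text \<open>The axiom of a CF-approximation space yields all of CF-closedness except
  \<open>up G \<subseteq> up F\<close>, which follows from \<open>G \<subseteq> up F\<close> by
  transitivity.\<close>

lemma up_closed:
  assumes "F \<in> \<F>"
  shows "up F \<in> \<CC>"
proof -
  have "\<exists>G\<in>\<F>. K \<subseteq> up G \<and> up G \<subseteq> up F \<and> G \<subseteq> up F" if K: "finite K" "K \<subseteq> up F" for K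
  proof -
    obtain G where "G \<in> \<F>" "K \<subseteq> up G" "G \<subseteq> up F"
      using up_interpolate[OF assms K] by blast
    then show ?thesis using upper_approx_trans[OF trans_R] by blast
  qed
  moreover have "up F \<subseteq> U" by (auto simp: upper_approx_def)
  ultimately show ?thesis unfolding cf_closed_sets_def by blast
qed

text \<open>A finite \<open>K\<close> already lies in a single member of the family, whose own
  closedness supplies the required \<open>F\<close>.\<close>

lemma directed_Union_closed:
  assumes "\<D> \<subseteq> \<CC>" "\<D> \<noteq> {}"
    and "\<And>X Y. X \<in> \<D> \<Longrightarrow> Y \<in> \<D> \<Longrightarrow> \<exists>Z\<in>\<D>. X \<subseteq> Z \<and> Y \<subseteq> Z"
  shows "\<Union>\<D> \<in> \<CC>"
proof -
  have "\<exists>F\<in>\<F>. K \<subseteq> up F \<and> up F \<subseteq> \<Union>\<D> \<and> F \<subseteq> \<Union>\<D>" if K: "finite K" "K \<subseteq> \<Union>\<D>" for K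
  proof -
    obtain X where X: "X \<in> \<D>" "K \<subseteq> X"
      using finite_subset_directed_Union[OF K assms(2,3)] by blast
    then have "X \<in> \<CC>" using assms(1) by blast
    then obtain F where "F \<in> \<F>" "K \<subseteq> up F" "up F \<subseteq> X" "F \<subseteq> X"
      using closed_interpolate[of X K] X(2) K(1) by blast
    then show ?thesis using X(1) by blast
  qed
  moreover have "\<Union>\<D> \<subseteq> U" using assms(1) by (auto simp: cf_closed_sets_def)
  ultimately show ?thesis unfolding cf_closed_sets_def by blast
qed

lemma directed_in_le_iff:
  "directed_in \<CC> le \<D> \<longleftrightarrow>
    \<D> \<subseteq> \<CC> \<and> \<D> \<noteq> {} \<and> (\<forall>X\<in>\<D>. \<forall>Y\<in>\<D>. \<exists>Z\<in>\<D>. X \<subseteq> Z \<and> Y \<subseteq> Z)"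
proof (cases "\<D> \<subseteq> \<CC>")
  case True
  then have "(X, Z) \<in> le \<longleftrightarrow> X \<subseteq> Z" if "X \<in> \<D>" "Z \<in> \<D>" for X Z
    using that by (auto simp: relation_of_def)
  then show ?thesis using True unfolding directed_in_def by simp
next
  case False
  then show ?thesis by (simp add: directed_in_def)
qed

lemma is_supremum_le_iff:
  assumes "\<A> \<subseteq> \<CC>"
  shows "is_supremum le \<A> S \<longleftrightarrow>
    S \<in> \<CC> \<and> (\<forall>X\<in>\<A>. X \<subseteq> S) \<and> (\<forall>Y\<in>\<CC>. (\<forall>X\<in>\<A>. X \<subseteq> Y) \<longrightarrow> S \<subseteq> Y)"
proof -
  have le_iff: "(X, Y) \<in> le \<longleftrightarrow> X \<subseteq> Y" if "X \<in> \<CC>" "Y \<in> \<CC>" for X Y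
    using that by (simp add: relation_of_def)
  then have "(\<forall>X\<in>\<A>. (X, Y) \<in> le) \<longleftrightarrow> (\<forall>X\<in>\<A>. X \<subseteq> Y)" if "Y \<in> \<CC>" for Y
    using that subsetD[OF assms] by (intro ball_cong refl) simp
  then show ?thesis
    unfolding is_supremum_iff[OF partial_order_on_relation_of_subset]
    by (simp add: le_iff cong: conj_cong)
qed

lemma is_supremum_directed_Union:
  assumes "directed_in \<CC> le \<D>"
  shows "is_supremum le \<D> (\<Union>\<D>)"
proof -
  have "\<D> \<subseteq> \<CC>" "\<Union>\<D> \<in> \<CC>"
    using assms directed_Union_closed[of \<D>] by (simp_all add: directed_in_le_iff)
  then show ?thesis by (simp add: is_supremum_le_iff Union_upper Union_least)
qed

lemma basis_directed:
  assumes "E \<in> \<CC>"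
  shows "directed_in \<CC> le (up ` {F \<in> \<F>. F \<subseteq> E})"
  unfolding directed_in_le_iff
proof (intro conjI ballI)
  show "up ` {F \<in> \<F>. F \<subseteq> E} \<subseteq> \<CC>" using up_closed by blast
  \<comment> \<open>Closedness at the empty \<open>K\<close> still produces some \<open>F\<close> in
    \<open>\<F>\<close> inside \<open>E\<close>.\<close>
  show "up ` {F \<in> \<F>. F \<subseteq> E} \<noteq> {}" using closed_interpolate[of E "{}"] assms by blast
  fix X Y assume "X \<in> up ` {F \<in> \<F>. F \<subseteq> E}" "Y \<in> up ` {F \<in> \<F>. F \<subseteq> E}"
  then obtain F G where FG: "F \<in> \<F>" "F \<subseteq> E" "X = up F" "G \<in> \<F>" "G \<subseteq> E" "Y = up G"
    by auto
  \<comment> \<open>Closedness is applied to the finite set \<open>F \<union> G\<close>; this is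
    where finiteness of the members of \<open>\<F>\<close> enters.\<close>
  obtain H where H: "H \<in> \<F>" "F \<union> G \<subseteq> up H" "H \<subseteq> E"
    using closed_interpolate[of E "F \<union> G"] assms FG finite_F by auto
  then have "X \<subseteq> up H" "Y \<subseteq> up H"
    using FG(3,6) upper_approx_trans[OF trans_R] by simp_all
  then show "\<exists>Z\<in>up ` {F \<in> \<F>. F \<subseteq> E}. X \<subseteq> Z \<and> Y \<subseteq> Z" using H(1,3) by auto
qed

lemma basis_Union:
  assumes "E \<in> \<CC>"
  shows "\<Union>(up ` {F \<in> \<F>. F \<subseteq> E}) = E"
proof
  show "\<Union>(up ` {F \<in> \<F>. F \<subseteq> E}) \<subseteq> E"
    using up_subset_closed[OF assms] finite_F by auto
  show "E \<subseteq> \<Union>(up ` {F \<in> \<F>. F \<subseteq> E})"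
  proof
    fix x assume "x \<in> E"
    then obtain F where "F \<in> \<F>" "{x} \<subseteq> up F" "F \<subseteq> E"
      using closed_interpolate[of E "{x}"] assms by auto
    then show "x \<in> \<Union>(up ` {F \<in> \<F>. F \<subseteq> E})" by blast
  qed
qed

text \<open>From left to right, the relation is tested on the directed basis of \<open>E\<close>.
  From right to left, the finite set \<open>F\<close> lies in the union of the directed family,
  hence in one member, and that closed member contains \<open>up F\<close>.\<close>

lemma way_below_iff:
  assumes "E \<in> \<CC>" "X \<in> \<CC>"
  shows "way_below \<CC> le X E \<longleftrightarrow> (\<exists>F\<in>\<F>. F \<subseteq> E \<and> X \<subseteq> up F)"
proof
  assume "way_below \<CC> le X E"
  moreover have "(E, E) \<in> le" using assms by (simp add: relation_of_def)
  moreover have "is_supremum le (up ` {F \<in> \<F>. F \<subseteq> E}) E"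
    using is_supremum_directed_Union[OF basis_directed[OF assms(1)]]
    by (simp only: basis_Union[OF assms(1)])
  ultimately have "\<exists>Y\<in>up ` {F \<in> \<F>. F \<subseteq> E}. (X, Y) \<in> le"
    using basis_directed[OF assms(1)] by (simp only: way_below_def)
  then show "\<exists>F\<in>\<F>. F \<subseteq> E \<and> X \<subseteq> up F" by (auto simp: relation_of_def)
next
  assume "\<exists>F\<in>\<F>. F \<subseteq> E \<and> X \<subseteq> up F"
  then obtain F where F: "F \<in> \<F>" "F \<subseteq> E" "X \<subseteq> up F" by blast
  show "way_below \<CC> le X E"
    unfolding way_below_def
  proof (intro allI impI, elim conjE)
    fix \<D> S assume D: "directed_in \<CC> le \<D>" "is_supremum le \<D> S" "(E, S) \<in> le"
    have "S = \<Union>\<D>"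
      using is_supremum_unique[OF partial_order_on_relation_of_subset D(2)]
        is_supremum_directed_Union[OF D(1)] by blast
    then have "F \<subseteq> \<Union>\<D>" using D(3) F(2) by (auto simp: relation_of_def)
    then obtain Y where Y: "Y \<in> \<D>" "F \<subseteq> Y"
      using finite_subset_directed_Union[of F \<D>] D(1) finite_F[OF F(1)]
      unfolding directed_in_le_iff by blast
    then have "Y \<in> \<CC>" "up F \<subseteq> Y"
      using D(1) up_subset_closed finite_F[OF F(1)] by (auto simp: directed_in_le_iff)
    then show "\<exists>Y\<in>\<D>. (X, Y) \<in> le" using Y(1) F(3) assms(2) by (auto simp: relation_of_def)
  qed
qed

lemma continuous_domain_closed_sets: "continuous_domain \<CC> le"
proof -
  have "directed_in \<CC> le {X \<in> \<CC>. way_below \<CC> le X E} \<and>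
      is_supremum le {X \<in> \<CC>. way_below \<CC> le X E} E" if E: "E \<in> \<CC>" for E
  proof -
    \<comment> \<open>By \<open>way_below_iff\<close>, the family \<open>\<D>\<close> consists of
      the closed sets lying under a member of \<open>\<B>\<close>. So \<open>\<B>\<close> is cofinal
      in \<open>\<D>\<close>, and \<open>\<D>\<close> inherits its directedness and its union
      \<open>E\<close>.\<close>
    define \<B> where "\<B> = up ` {F \<in> \<F>. F \<subseteq> E}"
    define \<D> where "\<D> = {X \<in> \<CC>. way_below \<CC> le X E}"
    have D: "X \<in> \<D> \<longleftrightarrow> X \<in> \<CC> \<and> (\<exists>Y\<in>\<B>. X \<subseteq> Y)" for X
    proof -
      have "(\<exists>Y\<in>\<B>. X \<subseteq> Y) \<longleftrightarrow> (\<exists>F\<in>\<F>. F \<subseteq> E \<and> X \<subseteq> up F)"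
        unfolding \<B>_def by blast
      then show ?thesis
        using way_below_iff[OF E, of X] unfolding \<D>_def mem_Collect_eq by argo
    qed
    have B: "\<B> \<subseteq> \<CC> \<and> \<B> \<noteq> {} \<and> (\<forall>X\<in>\<B>. \<forall>Y\<in>\<B>. \<exists>Z\<in>\<B>. X \<subseteq> Z \<and> Y \<subseteq> Z)"
      unfolding \<B>_def by (rule basis_directed[OF E, unfolded directed_in_le_iff])
    have "\<B> \<subseteq> \<D>" using B by (auto simp: D)
    have dir: "directed_in \<CC> le \<D>"
      unfolding directed_in_le_iff
    proof (intro conjI ballI)
      show "\<D> \<subseteq> \<CC>" by (auto simp: D)
      show "\<D> \<noteq> {}" using \<open>\<B> \<subseteq> \<D>\<close> B by auto
      fix X Y assume "X \<in> \<D>" "Y \<in> \<D>"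
      then obtain X' Y' where "X' \<in> \<B>" "X \<subseteq> X'" "Y' \<in> \<B>" "Y \<subseteq> Y'"
        unfolding D by blast
      moreover then obtain Z where "Z \<in> \<B>" "X' \<subseteq> Z" "Y' \<subseteq> Z"
        using B by meson
      ultimately have "Z \<in> \<D>" "X \<subseteq> Z" "Y \<subseteq> Z" using \<open>\<B> \<subseteq> \<D>\<close> by auto
      then show "\<exists>Z\<in>\<D>. X \<subseteq> Z \<and> Y \<subseteq> Z" by blast
    qed
    have "\<Union>\<D> \<subseteq> \<Union>\<B>"
    proof (rule Union_least)
      fix X assume "X \<in> \<D>"
      then obtain Y where "Y \<in> \<B>" "X \<subseteq> Y" unfolding D by auto
      then show "X \<subseteq> \<Union>\<B>" by auto
    qed
    then have "\<Union>\<D> = \<Union>\<B>" using Union_mono[OF \<open>\<B> \<subseteq> \<D>\<close>] by (rule subset_antisym)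
    also have "\<dots> = E" unfolding \<B>_def by (rule basis_Union[OF E])
    finally show ?thesis
      using dir is_supremum_directed_Union[OF dir] by (simp add: \<D>_def)
  qed
  moreover have "\<exists>S. is_supremum le \<D> S" if "directed_in \<CC> le \<D>" for \<D>
    using is_supremum_directed_Union[OF that] by blast
  ultimately show ?thesis
    by (simp add: continuous_domain_def dcpo_def partial_order_on_relation_of_subset)
qed

end

section \<open>Suprema of bounded families of CF-closed sets\<close>

lemma bc_domain_closed_sets:
  assumes "bc_approx_space U R \<F>"
  shows "bc_domain (cf_closed_sets U R \<F>) (relation_of (\<subseteq>) (cf_closed_sets U R \<F>))"
proof -
  interpret cf_space U R \<F> using assms by unfold_locales (simp add: bc_approx_space_def)
  have "\<exists>S. is_supremum le \<A> S" if A: "\<A> \<subseteq> \<CC>" "Above le \<A> \<noteq> {}" for \<A>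
  proof -
    obtain B where B: "B \<in> \<CC>" "\<forall>X\<in>\<A>. X \<subseteq> B"
      using A(2) by (auto simp: Above_def relation_of_def Field_def)
    \<comment> \<open>The empty subfamily is allowed, so \<open>{}\<close> belongs to
      \<open>Fin\<close>. This keeps \<open>\<S>\<close> nonempty even when \<open>\<A>\<close> is
      empty, in which case the construction yields the least closed set.\<close>
    define Fin where "Fin = {\<Union>\<M> | \<M>. \<M> \<subseteq> {F \<in> \<F>. \<exists>X\<in>\<A>. F \<subseteq> X} \<and> finite \<M>}"
    \<comment> \<open>This is what remains of (sL-1) and (sL-2') when the bound \<open>F\<close> is
      dropped. Any two such \<open>G\<close> for the same \<open>M\<close> have equal
      \<open>up G\<close>, by minimality in both directions.\<close>
    define least where "least = (\<lambda>M G. G \<in> \<F> \<and> up M \<subseteq> up G \<and>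
      (\<forall>G'\<in>\<F>. up M \<subseteq> up G' \<longrightarrow> up G \<subseteq> up G'))"
    define \<S> where "\<S> = {up G | M G. M \<in> Fin \<and> least M G}"
    have Fin_sub: "M \<subseteq> Y" if "M \<in> Fin" "\<forall>X\<in>\<A>. X \<subseteq> Y" for M Y
      using that by (fastforce simp: Fin_def)
    have Fin_finite: "finite M" if "M \<in> Fin" for M
      using that finite_F by (auto simp: Fin_def)
    have Fin_Un: "M \<union> N \<in> Fin" if MN: "M \<in> Fin" "N \<in> Fin" for M N
    proof -
      obtain \<M> \<N> where "M = \<Union>\<M>" "N = \<Union>\<N>" "finite \<M>" "finite \<N>"
        "\<M> \<subseteq> {F \<in> \<F>. \<exists>X\<in>\<A>. F \<subseteq> X}" "\<N> \<subseteq> {F \<in> \<F>. \<exists>X\<in>\<A>. F \<subseteq> X}"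
        using MN by (auto simp: Fin_def)
      then have "M \<union> N = \<Union>(\<M> \<union> \<N>)" "finite (\<M> \<union> \<N>)"
        "\<M> \<union> \<N> \<subseteq> {F \<in> \<F>. \<exists>X\<in>\<A>. F \<subseteq> X}" by auto
      then show ?thesis unfolding Fin_def by blast
    qed
    have Fin_empty: "{} \<in> Fin" unfolding Fin_def by (auto intro!: exI[of _ "{}"])
    have ex_least: "\<exists>G. least M G" if M: "M \<in> Fin" for M
    proof -
      \<comment> \<open>The common bound \<open>B\<close> is used here: it contains the finite set
        \<open>M\<close>, so its closedness provides the \<open>F\<close> that the bc-axiom
        requires.\<close>
      obtain F where "F \<in> \<F>" "M \<subseteq> up F"
        using closed_interpolate[OF B(1) Fin_finite[OF M] Fin_sub[OF M B(2)]] by blast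
      moreover have "M \<in> join_saturation \<F> \<union> {{}}"
        using M unfolding Fin_def join_saturation_def by blast
      moreover have "\<forall>M \<in> join_saturation \<F> \<union> {{}}. \<forall>F\<in>\<F>. M \<subseteq> up F \<longrightarrow>
          (\<exists>G\<in>\<F>. up M \<subseteq> up G \<and> up G \<subseteq> up F \<and>
            (\<forall>G'\<in>\<F>. up M \<subseteq> up G' \<longrightarrow> up G \<subseteq> up G'))"
        using assms unfolding bc_approx_space_def by (rule conjunct2)
      ultimately show ?thesis unfolding least_def by meson
    qed
    have least_upper: "up M \<subseteq> up G" if "least M G" for M G
      using that by (simp add: least_def)
    have least_minimal: "up G \<subseteq> up G'" if "least M G" "G' \<in> \<F>" "up M \<subseteq> up G'" for M G G'
      using that by (simp add: least_def)
    have S_I: "up G \<in> \<S>" if "M \<in> Fin" "least M G" for M G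
      using that unfolding \<S>_def by blast
    have S_closed: "\<S> \<subseteq> \<CC>" using up_closed by (auto simp: \<S>_def least_def)
    have "directed_in \<CC> le \<S>"
      unfolding directed_in_le_iff
    proof (intro conjI ballI)
      show "\<S> \<noteq> {}" using ex_least[OF Fin_empty] S_I[OF Fin_empty] by blast
      fix X Y assume "X \<in> \<S>" "Y \<in> \<S>"
      then obtain M G N H where XY: "X = up G" "M \<in> Fin" "least M G" "Y = up H" "N \<in> Fin" "least N H"
        by (auto simp: \<S>_def)
      then have MN: "M \<union> N \<in> Fin" using Fin_Un by blast
      then obtain K where K: "least (M \<union> N) K" using ex_least by blast
      \<comment> \<open>Hence \<open>K\<close> competes in the minimality of both \<open>G\<close>
        and \<open>H\<close>, which makes \<open>up K\<close> an upper bound of \<open>X\<close> and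
        \<open>Y\<close>.\<close>
      have "up M \<subseteq> up (M \<union> N)" "up N \<subseteq> up (M \<union> N)" by (simp_all add: upper_approx_mono)
      then have "up M \<subseteq> up K" "up N \<subseteq> up K"
        using least_upper[OF K] by (meson subset_trans)+
      moreover have "K \<in> \<F>" using K by (simp add: least_def)
      ultimately have "X \<subseteq> up K" "Y \<subseteq> up K"
        using XY least_minimal by simp_all
      then show "\<exists>Z\<in>\<S>. X \<subseteq> Z \<and> Y \<subseteq> Z" using S_I[OF MN K] by blast
    qed (rule S_closed)
    from is_supremum_directed_Union[OF this] have S_mem: "\<Union>\<S> \<in> \<CC>"
      by (simp add: is_supremum_le_iff[OF S_closed])
    have S_upper: "X \<subseteq> \<Union>\<S>" if X: "X \<in> \<A>" for X
    proof -
      \<comment> \<open>It suffices to bound the basis of \<open>X\<close>; each of its sets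
        \<open>F\<close> is itself a member of \<open>Fin\<close>, through the one-element
        subfamily.\<close>
      have "up F \<subseteq> \<Union>\<S>" if F: "F \<in> \<F>" "F \<subseteq> X" for F
      proof -
        have "F \<in> Fin" using F X unfolding Fin_def by (auto intro!: exI[of _ "{F}"])
        then obtain G where "least F G" using ex_least by blast
        then have "up F \<subseteq> up G" "up G \<in> \<S>" using least_upper S_I \<open>F \<in> Fin\<close> by simp_all
        then show ?thesis by blast
      qed
      then have "\<Union>(up ` {F \<in> \<F>. F \<subseteq> X}) \<subseteq> \<Union>\<S>" by (intro Union_least) auto
      moreover have "X \<in> \<CC>" using X A(1) by blast
      ultimately show ?thesis by (simp only: basis_Union)
    qed
    have S_least: "\<Union>\<S> \<subseteq> Y" if Y: "Y \<in> \<CC>" "\<forall>X\<in>\<A>. X \<subseteq> Y" for Y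
    proof -
      have "up G \<subseteq> Y" if G: "M \<in> Fin" "least M G" for M G
      proof -
        \<comment> \<open>The closed bound \<open>Y\<close> may have nothing to do with
          \<open>B\<close>. Interpolating in \<open>Y\<close> gives a competitor \<open>F\<close>
          for the minimality of \<open>G\<close>, so \<open>up G\<close> stays below
          \<open>Y\<close>.\<close>
        obtain F where F: "F \<in> \<F>" "M \<subseteq> up F" "up F \<subseteq> Y"
          using closed_interpolate[OF Y(1) Fin_finite[OF G(1)] Fin_sub[OF G(1) Y(2)]] by blast
        have "up G \<subseteq> up F"
          by (rule least_minimal[OF G(2) F(1) upper_approx_trans[OF trans_R F(2)]])
        then show ?thesis using F(3) by (rule subset_trans)
      qed
      then show ?thesis unfolding \<S>_def by (intro Union_least) auto
    qed
    have "is_supremum le \<A> (\<Union>\<S>)"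
      unfolding is_supremum_le_iff[OF A(1)]
    proof (intro conjI ballI impI)
      show "\<Union>\<S> \<subseteq> Y" if "Y \<in> \<CC>" "\<forall>X\<in>\<A>. X \<subseteq> Y" for Y
        using that by (rule S_least)
    qed (rule S_mem, erule S_upper)
    then show ?thesis by blast
  qed
  then show ?thesis using continuous_domain_closed_sets by (auto simp: bc_domain_def)
qed

section \<open>The approximation space of a continuous domain\<close>

locale cont_domain =
  fixes L :: "'a set" and r :: "'a rel"
  assumes cd: "continuous_domain L r"
begin

lemma po: "partial_order_on L r"
  using cd by (simp add: continuous_domain_def dcpo_def)

abbreviation waybelow_rel :: "'a rel" where
  "waybelow_rel \<equiv> {(x, y). x \<in> L \<and> y \<in> L \<and> way_below L r x y}"

abbreviation below :: "'a \<Rightarrow> 'a set" where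
  "below x \<equiv> {y \<in> L. way_below L r y x}"

lemmas po_refl = partial_order_on_refl[OF po]
  and po_trans = partial_order_on_trans[OF po]
  and po_antisym = partial_order_on_antisym[OF po]
  and sup_iff = is_supremum_iff[OF po]

lemma below_directed: "x \<in> L \<Longrightarrow> directed_in L r (below x)"
  and below_supremum: "x \<in> L \<Longrightarrow> is_supremum r (below x) x"
  using cd by (auto simp: continuous_domain_def)

lemma way_below_le:
  assumes "x \<in> L" "y \<in> L" "way_below L r x y"
  shows "(x, y) \<in> r"
  using assms(1,3) below_supremum[OF assms(2)] by (auto simp: sup_iff)

lemma way_below_mono:
  assumes "(x', x) \<in> r" "way_below L r x y" "(y, y') \<in> r"
  shows "way_below L r x' y'"
  unfolding way_below_def
proof (intro allI impI, elim conjE)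
  fix D s assume D: "directed_in L r D" "is_supremum r D s" "(y', s) \<in> r"
  then have "(y, s) \<in> r" using assms(3) po_trans by blast
  then obtain d where "d \<in> D" "(x, d) \<in> r"
    using assms(2) D(1,2) unfolding way_below_def by blast
  then show "\<exists>d\<in>D. (x', d) \<in> r" using assms(1) po_trans by blast
qed

text \<open>Each point is the supremum of the points way below it, so \<open>below\<close> embeds
  the order of \<open>L\<close> into inclusion.\<close>

lemma below_subset_iff:
  assumes "x \<in> L" "y \<in> L"
  shows "below x \<subseteq> below y \<longleftrightarrow> (x, y) \<in> r"
proof
  assume "below x \<subseteq> below y"
  then have "\<forall>z\<in>below x. (z, y) \<in> r" using assms(2) way_below_le by blast
  then show "(x, y) \<in> r" using below_supremum[OF assms(1)] assms(2) by (auto simp: sup_iff)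
next
  assume "(x, y) \<in> r"
  then show "below x \<subseteq> below y" using way_below_mono po_refl by blast
qed

lemma directed_finite_bound:
  assumes "directed_in L r D" "finite K" "\<forall>k\<in>K. \<exists>d\<in>D. (k, d) \<in> r"
  shows "\<exists>d\<in>D. \<forall>k\<in>K. (k, d) \<in> r"
  using assms(2,3)
proof (induction K)
  case empty
  then show ?case using assms(1) by (auto simp: directed_in_def)
next
  case (insert k K)
  then obtain d e where "d \<in> D" "\<forall>k\<in>K. (k, d) \<in> r" "e \<in> D" "(k, e) \<in> r" by auto
  moreover obtain z where "z \<in> D" "(d, z) \<in> r" "(e, z) \<in> r"
    using assms(1) calculation unfolding directed_in_def by blast
  ultimately show ?case using po_trans by blast
qed

text \<open>The points \<open>z\<close> with \<open>z \<lless> y \<lless> x\<close> for some \<open>y\<close> form a directed set with supremum \<open>x\<close>.\<close>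

lemma interpolation:
  assumes x: "x \<in> L" and K: "finite K" "K \<subseteq> below x"
  shows "\<exists>y\<in>below x. K \<subseteq> below y"
proof -
  let ?D = "\<Union>y\<in>below x. below y"
  have dir: "directed_in L r ?D"
    unfolding directed_in_def
  proof (intro conjI ballI)
    obtain y where "y \<in> below x" using below_directed[OF x] by (auto simp: directed_in_def)
    moreover then obtain z where "z \<in> below y"
      using below_directed[of y] by (auto simp: directed_in_def)
    ultimately show "?D \<noteq> {}" by blast
    fix a b assume "a \<in> ?D" "b \<in> ?D"
    then obtain y y' where ab: "y \<in> below x" "a \<in> below y" "y' \<in> below x" "b \<in> below y'" by blast
    then obtain z where z: "z \<in> below x" "(y, z) \<in> r" "(y', z) \<in> r"
      using below_directed[OF x] unfolding directed_in_def by blast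
    then have "a \<in> below z" "b \<in> below z" using ab way_below_mono po_refl by blast+
    then obtain c where "c \<in> below z" "(a, c) \<in> r" "(b, c) \<in> r"
      using below_directed[of z] z(1) unfolding directed_in_def by blast
    then show "\<exists>c\<in>?D. (a, c) \<in> r \<and> (b, c) \<in> r" using z(1) by blast
  qed auto
  have sup: "is_supremum r ?D x"
    unfolding sup_iff
  proof (intro conjI ballI impI)
    fix a assume "a \<in> ?D"
    then show "(a, x) \<in> r" using x way_below_le po_trans by blast
  next
    \<comment> \<open>Continuity is used twice: \<open>u\<close> bounds every
      \<open>below y\<close>, hence every \<open>y\<close> in \<open>below x\<close>, hence
      \<open>x\<close>.\<close>
    fix u assume u: "u \<in> L" "\<forall>a\<in>?D. (a, u) \<in> r"
    have "(y, u) \<in> r" if "y \<in> below x" for y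
      using u that below_supremum[of y] by (auto simp: sup_iff)
    then show "(x, u) \<in> r" using below_supremum[OF x] u(1) by (simp add: sup_iff)
  qed (rule x)
  \<comment> \<open>Each \<open>k\<close> is way below the supremum of \<open>?D\<close>, so it lies
    under a member of \<open>?D\<close>. A common bound \<open>d\<close> of \<open>K\<close> in
    \<open>?D\<close> is way below some \<open>y\<close>, and this \<open>y\<close>
    interpolates.\<close>
  have "\<forall>k\<in>K. \<exists>d\<in>?D. (k, d) \<in> r"
    using K(2) dir sup po_refl[OF x] unfolding way_below_def by blast
  then obtain d where "d \<in> ?D" "\<forall>k\<in>K. (k, d) \<in> r"
    using directed_finite_bound[OF dir K(1)] by blast
  then obtain y where "y \<in> below x" "d \<in> below y" by blast
  moreover have "K \<subseteq> below y"
  proof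
    fix k assume "k \<in> K"
    moreover have "(y, y) \<in> r" using \<open>y \<in> below x\<close> po_refl by blast
    ultimately show "k \<in> below y"
      using \<open>\<forall>k\<in>K. (k, d) \<in> r\<close> \<open>d \<in> below y\<close> K(2) way_below_mono by blast
  qed
  ultimately show ?thesis by blast
qed

section \<open>The space of singletons with the way-below relation\<close>

abbreviation singletons :: "'a set set" where
  "singletons \<equiv> (\<lambda>x. {x}) ` L"

lemma upper_approx_singleton: "x \<in> L \<Longrightarrow> upper_approx L waybelow_rel {x} = below x"
  by (auto simp: upper_approx_def)

text \<open>For singletons the CF-axiom is exactly the interpolation property: with
  \<open>F = {x}\<close>, the interpolating point \<open>y\<close> gives
  \<open>G = {y}\<close>.\<close>

lemma cf_approx_space_singletons:
  assumes "L \<noteq> {}"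
  shows "cf_approx_space L waybelow_rel singletons"
proof -
  have "trans waybelow_rel"
    by (rule transI) (use way_below_mono way_below_le po_refl in blast)
  moreover have "\<exists>G\<in>singletons. K \<subseteq> upper_approx L waybelow_rel G \<and>
      G \<subseteq> upper_approx L waybelow_rel F"
    if F: "F \<in> singletons" and K: "finite K" "K \<subseteq> upper_approx L waybelow_rel F" for F K
  proof -
    obtain x where "x \<in> L" "F = {x}" using F by blast
    moreover then obtain y where "y \<in> below x" "K \<subseteq> below y"
      using interpolation[of x K] K upper_approx_singleton by auto
    ultimately show ?thesis
      using upper_approx_singleton by (auto intro!: bexI[of _ "{y}"])
  qed
  ultimately show ?thesis using assms unfolding cf_approx_space_def by auto
qed

lemma below_closed:
  assumes "x \<in> L"
  shows "below x \<in> cf_closed_sets L waybelow_rel singletons"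
proof -
  have "L \<noteq> {}" using assms by blast
  then interpret cf_space L waybelow_rel singletons
    by unfold_locales (rule cf_approx_space_singletons)
  show ?thesis using up_closed[of "{x}"] assms upper_approx_singleton by simp
qed

text \<open>The point is the supremum of \<open>E\<close>, which exists because closedness at
  two-element sets makes \<open>E\<close> directed.\<close>

lemma closed_eq_below:
  assumes E: "E \<in> cf_closed_sets L waybelow_rel singletons"
  shows "\<exists>x\<in>L. E = below x"
proof -
  have EL: "E \<subseteq> L" using E by (simp add: cf_closed_sets_def)
  have rounded: "\<exists>x\<in>E. K \<subseteq> below x \<and> below x \<subseteq> E" if K: "finite K" "K \<subseteq> E" for K
  proof -
    have "\<exists>F\<in>singletons. K \<subseteq> upper_approx L waybelow_rel F \<and>
        upper_approx L waybelow_rel F \<subseteq> E \<and> F \<subseteq> E"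
      using E K by (simp only: cf_closed_sets_def mem_Collect_eq)
    then obtain x where "x \<in> L" "K \<subseteq> upper_approx L waybelow_rel {x}"
      "upper_approx L waybelow_rel {x} \<subseteq> E" "{x} \<subseteq> E"
      by auto
    then show ?thesis using upper_approx_singleton by auto
  qed
  have dir: "directed_in L r E"
    unfolding directed_in_def
  proof (intro conjI ballI)
    show "E \<noteq> {}" using rounded[of "{}"] by blast
    fix a b assume "a \<in> E" "b \<in> E"
    then obtain x where "x \<in> E" "{a, b} \<subseteq> below x" using rounded[of "{a, b}"] by auto
    then show "\<exists>x\<in>E. (a, x) \<in> r \<and> (b, x) \<in> r" using EL way_below_le by blast
  qed (rule EL)
  then obtain s where s: "is_supremum r E s"
    using cd unfolding continuous_domain_def dcpo_def by blast
  then have sL: "s \<in> L" and upper: "\<forall>e\<in>E. (e, s) \<in> r" by (auto simp: sup_iff)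
  have "E = below s"
  proof (intro subset_antisym subsetI)
    fix y assume "y \<in> E"
    then obtain x where "x \<in> E" "y \<in> below x" using rounded[of "{y}"] by auto
    then show "y \<in> below s" using upper way_below_mono po_refl by blast
  next
    \<comment> \<open>A point way below \<open>s\<close> lies under some \<open>d\<close> in
      \<open>E\<close>, and \<open>d\<close> is way below some \<open>x\<close> with
      \<open>below x\<close> inside \<open>E\<close>; so \<open>y\<close> is in
      \<open>below x\<close>.\<close>
    fix y assume y: "y \<in> below s"
    then obtain d where d: "d \<in> E" "(y, d) \<in> r"
      using dir s po_refl[OF sL] unfolding way_below_def by blast
    then obtain x where x: "x \<in> E" "d \<in> below x" "below x \<subseteq> E" using rounded[of "{d}"] by auto
    moreover have "(x, x) \<in> r" using x EL po_refl by blast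
    ultimately show "y \<in> E" using y d(2) way_below_mono by blast
  qed
  then show ?thesis using sL by blast
qed

lemma order_isomorphic_closed_sets:
  defines "\<C> \<equiv> cf_closed_sets L waybelow_rel singletons"
  shows "order_isomorphic L r \<C> (relation_of (\<subseteq>) \<C>)"
proof -
  have "inj_on below L"
  proof (rule inj_onI)
    fix x y assume xy: "x \<in> L" "y \<in> L" "below x = below y"
    then have "(x, y) \<in> r" "(y, x) \<in> r" by (simp_all flip: below_subset_iff)
    then show "x = y" by (rule po_antisym)
  qed
  moreover have "below ` L = \<C>"
    using below_closed closed_eq_below unfolding \<C>_def by auto
  ultimately have "bij_betw below L \<C>" by (simp add: bij_betw_def)
  moreover have "(x, y) \<in> r \<longleftrightarrow> (below x, below y) \<in> relation_of (\<subseteq>) \<C>"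
    if "x \<in> L" "y \<in> L" for x y
    using that below_closed below_subset_iff by (simp add: relation_of_def \<C>_def)
  ultimately show ?thesis unfolding order_isomorphic_def by blast
qed

end

section \<open>The two directions of the equivalence\<close>

lemma bc_domain_represented:
  assumes "bc_domain L r" "L \<noteq> {}"
  shows "\<exists>(U :: 'a set) R \<F>. bc_represents U R \<F> (L :: 'a set) r"
proof -
  interpret cont_domain L r using assms(1) by unfold_locales (simp add: bc_domain_def)
  let ?up = "upper_approx L waybelow_rel"
  \<comment> \<open>Both nonempty finite unions and the empty set are covered by this
    \<open>M\<close>; for \<open>M = {}\<close> the supremum \<open>g\<close> below is the least
    element of \<open>L\<close>.\<close>
  have "\<exists>G\<in>singletons. ?up M \<subseteq> ?up G \<and> ?up G \<subseteq> ?up F \<and>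
      (\<forall>G'\<in>singletons. ?up M \<subseteq> ?up G' \<longrightarrow> ?up G \<subseteq> ?up G')"
    if F: "F \<in> singletons" and M: "M \<subseteq> ?up F" for M F
  proof -
    obtain x where x: "x \<in> L" "F = {x}" using F by blast
    then have Mx: "M \<subseteq> below x" using M upper_approx_singleton by simp
    then have M_sub: "M \<subseteq> L" by blast
    have x_above: "\<forall>m\<in>M. (m, x) \<in> r" using Mx x(1) way_below_le by blast
    then have "Above r M \<noteq> {}"
      using x(1) by (auto simp: Above_def partial_order_on_Field[OF po])
    then obtain g where g: "is_supremum r M g" using assms(1) M_sub unfolding bc_domain_def by blast
    then have gL: "g \<in> L" by (simp add: sup_iff)
    \<comment> \<open>This turns inclusions of \<open>?up M\<close> into statements about upper
      bounds of \<open>M\<close>: (sL-1) and (sL-2') for \<open>{g}\<close> then say that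
      \<open>g\<close> is an upper bound of \<open>M\<close> under \<open>x\<close> and the least
      one.\<close>
    have up_M: "?up M \<subseteq> below u \<longleftrightarrow> (\<forall>m\<in>M. (m, u) \<in> r)" if "u \<in> L" for u
    proof -
      have "?up M = (\<Union>m\<in>M. below m)" using M_sub by (auto simp: upper_approx_def)
      then have "?up M \<subseteq> below u \<longleftrightarrow> (\<forall>m\<in>M. below m \<subseteq> below u)" by (simp only: UN_subset_iff)
      then show ?thesis using below_subset_iff that M_sub by blast
    qed
    have "?up M \<subseteq> ?up {g}"
      using g gL by (simp add: upper_approx_singleton up_M sup_iff)
    moreover have "?up {g} \<subseteq> ?up F"
      using g gL x x_above by (simp only: upper_approx_singleton below_subset_iff sup_iff)
    moreover have "\<forall>G'\<in>singletons. ?up M \<subseteq> ?up G' \<longrightarrow> ?up {g} \<subseteq> ?up G'"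
    proof
      fix G' assume "G' \<in> singletons"
      then obtain u where "u \<in> L" "G' = {u}" by blast
      then show "?up M \<subseteq> ?up G' \<longrightarrow> ?up {g} \<subseteq> ?up G'"
        using g gL by (simp only: upper_approx_singleton up_M below_subset_iff sup_iff) blast
    qed
    ultimately show ?thesis using gL by blast
  qed
  then have "bc_approx_space L waybelow_rel singletons"
    using cf_approx_space_singletons[OF assms(2)] unfolding bc_approx_space_def by blast
  then show ?thesis
    using order_isomorphic_sym[OF order_isomorphic_closed_sets] unfolding bc_represents_def by blast
qed

lemma bc_represents_imp_bc_domain:
  assumes "partial_order_on L r" "bc_represents U R \<F> L r"
  shows "bc_domain L r"
proof (rule bc_domain_order_isomorphic[OF partial_order_on_relation_of_subset assms(1)])
  show "order_isomorphic (cf_closed_sets U R \<F>) (relation_of (\<subseteq>) (cf_closed_sets U R \<F>)) L r"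
    using assms(2) unfolding bc_represents_def by (rule conjunct2)
  show "bc_domain (cf_closed_sets U R \<F>) (relation_of (\<subseteq>) (cf_closed_sets U R \<F>))"
    using assms(2) unfolding bc_represents_def by (intro bc_domain_closed_sets) (rule conjunct1)
qed

text \<open>The space built from a bc-domain has its points in \<open>L\<close>, so type
  \<open>'a\<close> suffices for existence; the second conjunct extends the converse to spaces over
  an arbitrary type \<open>'b\<close>.\<close>

theorem theorem5p9:
  fixes L :: "'a set" and r :: "'a rel"
  assumes "partial_order_on L r" and "L \<noteq> {}"
  shows "(bc_domain L r \<longleftrightarrow>
            (\<exists>(U :: 'a set) R \<F>. bc_represents U R \<F> L r)) \<and>
         ((\<exists>(U :: 'b set) R \<F>. bc_represents U R \<F> L r) \<longrightarrow> bc_domain L r)"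
proof (intro conjI iffI impI)
  show "\<exists>(U :: 'a set) R \<F>. bc_represents U R \<F> L r" if "bc_domain L r"
    using that assms(2) by (rule bc_domain_represented)
  show "bc_domain L r" if "\<exists>(U :: 'a set) R \<F>. bc_represents U R \<F> L r"
    using that by (elim exE) (rule bc_represents_imp_bc_domain[OF assms(1)])
  show "bc_domain L r" if "\<exists>(U :: 'b set) R \<F>. bc_represents U R \<F> L r"
    using that by (elim exE) (rule bc_represents_imp_bc_domain[OF assms(1)])
qed

end
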